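(* Let $-\pi/2<\beta<\pi/2$ and $0\le\alpha<1$. For every $f\in\mathcal{S}_\beta(\alpha)$ with $f(z)=z+\sum_{n=2}^\infty a_nz^n$, we have $$|H_{2,1}(F_f/2)|\le \frac{(1-\alpha)^2\cos^2\beta}{4}.$$ Equality holds only for the rotations of the function $$f_1(z)=\frac{z}{(1-z^2)^{(1-\alpha)\cos\beta\, e^{i\beta}}};$$ that is, for $f\in\mathcal{S}_\beta(\alpha)$ equality holds if and only if $f(z)=e^{-i\theta}f_1(e^{i\theta}z)$ for some $\theta\in\mathbb{R}$.
   Context: Let $\mathbb{D}=\{z\in\mathbb{C}:|z|<1\}$ and let $\mathcal{A}$ be the class of analytic functions $f$ on $\mathbb{D}$ of the form $f(z)=z+\sum_{n=2}^\infty a_nz^n$. For $0\le\alpha<1$ and $-\pi/2<\beta<\pi/2$, the class of $\beta$-spirallike functions of order $\alpha$ is $$\mathcal{S}_\beta(\alpha)=\Big\{f\in\mathcal{A}:\ \mathrm{Re}\Big(e^{-i\beta}\frac{zf'(z)}{f(z)}\Big)>\alpha\cos\beta\ \text{ for } z\in\mathbb{D}\Big\}$$ (with $zf'(z)/f(z)$ taken to be $1$ at $z=0$, and $f(z)\neq 0$ for $z\ne 0$). The logarithmic coefficients $\gamma_n=\gamma_n(f)$ are defined by $F_f(z)=\log\frac{f(z)}{z}=2\sum_{n=1}^\infty\gamma_nz^n$ (branch with value $0$ at $z=0$), and the second Hankel determinant of the logarithmic coefficients is $$H_{2,1}(F_f/2)=\gamma_1\gamma_3-\gamma_2^2=\frac14\Big(a_2a_4-a_3^2+\frac1{12}a_2^4\Big).$$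 A rotation of $f$ is a function $z\mapsto e^{-i\theta}f(e^{i\theta}z)$, $\theta\in\mathbb{R}$. Complex powers of $1-z^2$ are taken with the branch equal to $1$ at $z=0$. *)

theory Defs
  imports "HOL-Complex_Analysis.Complex_Analysis"
begin

abbreviation unit_disc :: "complex set" where
  "unit_disc \<equiv> ball 0 1"

(* f(z) = z + a_2 z^2 + ... on the unit disc; values of f outside the disc are irrelevant. *)
definition class_A :: "(complex \<Rightarrow> complex) set" where
  "class_A = {f. f holomorphic_on unit_disc \<and> f 0 = 0 \<and> deriv f 0 = 1}"

definition spirallike :: "real \<Rightarrow> real \<Rightarrow> (complex \<Rightarrow> complex) set" where
  "spirallike \<beta> \<alpha> = {f \<in> class_A.
     (\<forall>z\<in>unit_disc - {0}. f z \<noteq> 0) \<and>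
     (\<forall>z\<in>unit_disc. Re (cis (- \<beta>) * (if z = 0 then 1 else z * deriv f z / f z)) > \<alpha> * cos \<beta>)}"

definition is_log_ratio :: "(complex \<Rightarrow> complex) \<Rightarrow> (complex \<Rightarrow> complex) \<Rightarrow> bool" where
  "is_log_ratio f F \<longleftrightarrow> F holomorphic_on unit_disc \<and> F 0 = 0 \<and>
     (\<forall>z\<in>unit_disc - {0}. exp (F z) = f z / z)"

(* The function F_f(z) = log (f(z)/z).  For f in class A without zeros in the punctured disc
   it exists and is unique on the disc (lemmas below); outside the disc it is arbitrary,
   which does not affect its Taylor coefficients at 0. *)
definition log_ratio :: "(complex \<Rightarrow> complex) \<Rightarrow> complex \<Rightarrow> complex" where
  "log_ratio f = (SOME F. is_log_ratio f F)"

definition log_coeff :: "(complex \<Rightarrow> complex) \<Rightarrow> nat \<Rightarrow> complex" where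
  "log_coeff f n = fps_nth (fps_expansion (log_ratio f) 0) n / 2"

(* H_{2,1}(F_f/2): the determinant with rows (gamma_1, gamma_2), (gamma_2, gamma_3). *)
definition log_hankel_2_1 :: "(complex \<Rightarrow> complex) \<Rightarrow> complex" where
  "log_hankel_2_1 f = log_coeff f 1 * log_coeff f 3 - (log_coeff f 2)\<^sup>2"

(* On the unit disc Re (1 - z^2) > 0, so the principal power powr is the branch equal to 1 at 0. *)
definition extremal_f1 :: "real \<Rightarrow> real \<Rightarrow> complex \<Rightarrow> complex" where
  "extremal_f1 \<alpha> \<beta> z = z / (1 - z\<^sup>2) powr (of_real ((1 - \<alpha>) * cos \<beta>) * cis \<beta>)"

definition is_rotation_of :: "(complex \<Rightarrow> complex) \<Rightarrow> (complex \<Rightarrow> complex) \<Rightarrow> bool" where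
  "is_rotation_of g f \<longleftrightarrow>
     (\<exists>\<theta>::real. \<forall>z\<in>unit_disc. g z = cis (- \<theta>) * f (cis \<theta> * z))"

lemma is_log_ratio_exists:
  assumes "f \<in> class_A" and nz: "\<And>z. z \<in> unit_disc - {0} \<Longrightarrow> f z \<noteq> 0"
  shows "\<exists>F. is_log_ratio f F"
proof -
  have f: "f holomorphic_on unit_disc" "f 0 = 0" "deriv f 0 = 1"
    using assms(1) by (auto simp: class_A_def)
  define h where "h z = (if z = 0 then 1 else f z / z)" for z
  have h: "h holomorphic_on unit_disc"
    by (rule pole_theorem_0[OF f(1), of 0]) (auto simp: h_def f)
  have hnz: "h z \<noteq> 0" if "z \<in> unit_disc" for z
    using nz[of z] that by (auto simp: h_def)
  obtain g where g: "g holomorphic_on unit_disc" "\<And>z. z \<in> unit_disc \<Longrightarrow> exp (g z) = h z"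
    using holomorphic_logarithm_exists[OF convex_ball open_ball h hnz, of 0] by auto
  have "exp (g 0) = 1"
    using g(2)[of 0] by (simp add: h_def)
  then have "is_log_ratio f (\<lambda>z. g z - g 0)"
    using g by (auto simp: is_log_ratio_def h_def exp_diff intro!: holomorphic_intros)
  then show ?thesis by blast
qed

lemma is_log_ratio_log_ratio:
  assumes "f \<in> class_A" and "\<And>z. z \<in> unit_disc - {0} \<Longrightarrow> f z \<noteq> 0"
  shows "is_log_ratio f (log_ratio f)"
  unfolding log_ratio_def using is_log_ratio_exists[OF assms] by (rule someI_ex)

lemma is_log_ratio_unique:
  assumes F: "is_log_ratio f F" and G: "is_log_ratio f G" and z: "z \<in> unit_disc"
  shows "F z = G z"
proof -
  define d where "d z = F z - G z" for z
  have hd: "d holomorphic_on unit_disc"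
    using F G unfolding d_def is_log_ratio_def by (auto intro!: holomorphic_intros)
  have ed: "exp (d w) = 1" if "w \<in> unit_disc" for w
  proof (cases "w = 0")
    case False
    then have "exp (F w) = exp (G w)" using F G that by (auto simp: is_log_ratio_def)
    then show ?thesis by (simp add: d_def exp_diff)
  qed (use F G in \<open>auto simp: d_def is_log_ratio_def\<close>)
  have "(d has_field_derivative 0) (at w)" if w: "w \<in> unit_disc" for w
  proof -
    have d: "(d has_field_derivative deriv d w) (at w)"
      using holomorphic_derivI[OF hd open_ball w] .
    have "((\<lambda>w. exp (d w)) has_field_derivative exp (d w) * deriv d w) (at w)"
      by (rule derivative_eq_intros d refl)+
    moreover have "((\<lambda>w. exp (d w)) has_field_derivative 0) (at w)"
      by (rule has_field_derivative_transform_within_open[OF DERIV_const[of 1] open_ball w])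
         (simp add: ed)
    ultimately have "exp (d w) * deriv d w = 0" by (rule DERIV_unique)
    then show ?thesis using d by simp
  qed
  then have "\<exists>c. \<forall>w\<in>unit_disc. d w = c"
    by (intro has_field_derivative_zero_constant) (auto intro: has_field_derivative_at_within)
  then have "d z = d 0" using z by force
  then show ?thesis using F G by (simp add: d_def is_log_ratio_def)
qed

lemma log_ratio_sums:
  assumes "f \<in> class_A" and "\<And>z. z \<in> unit_disc - {0} \<Longrightarrow> f z \<noteq> 0" and "z \<in> unit_disc"
  shows "(\<lambda>n. 2 * log_coeff f n * z ^ n) sums log_ratio f z"
  using holomorphic_power_series[of "log_ratio f" 0 1 z] is_log_ratio_log_ratio[OF assms(1,2)] assms(3)
  by (simp add: log_coeff_def fps_expansion_def is_log_ratio_def)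

end

theory Submission
  imports Defs
begin

text \<open>
  Put \<open>c = (1 - \<alpha>) cos \<beta> cis \<beta>\<close> and \<open>F(z) = log (f(z)/z)\<close>.  Spirallikeness says that
  \<open>1 + z F'(z)/c\<close> has positive real part, so \<open>z F'(z) (1 - w(z)) = 2 c w(z)\<close> for a Schwarz
  function \<open>w\<close>, and comparing coefficients gives
  \<open>H = (c^2/12) (4 w1 w3 + 2 w1^2 w2 + w1^4 - 3 w2^2)\<close>.
  Two steps of the Schur algorithm express \<open>w1\<close>, \<open>w2\<close>, \<open>w3\<close> through Schur parameters
  \<open>a\<close>, \<open>b\<close>, \<open>d\<close> in the closed disc, and the triangle inequality bounds the bracket by
  \<open>3 - 2 |a|^4\<close>.  Equality forces \<open>a = 0\<close> and \<open>|b| = 1\<close>, that is \<open>w(z) = b z^2\<close>.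
\<close>

section \<open>Schwarz lemma and one step of the Schur algorithm\<close>

lemma bounded_by_center_imp_constant:
  assumes "g holomorphic_on unit_disc" and "\<And>z. z \<in> unit_disc \<Longrightarrow> norm (g z) \<le> 1"
    and "\<xi> \<in> unit_disc" and "norm (g \<xi>) = 1" and "z \<in> unit_disc"
  shows "g z = g \<xi>"
proof -
  have "g constant_on unit_disc"
    by (rule maximum_modulus_principle[OF assms(1), of unit_disc \<xi>]) (use assms in auto)
  then show ?thesis
    using assms unfolding constant_on_def by metis
qed

text \<open>Away from 0 the bound on the quotient is the growth part of the Schwarz lemma; at 0,
  where nothing can be divided, it is the derivative part, since
  \<open>g 0 = deriv w 0\<close>.\<close>

lemma Schwarz_quotient:
  assumes hol: "w holomorphic_on unit_disc" and w0: "w 0 = 0"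
    and lt: "\<And>z. z \<in> unit_disc \<Longrightarrow> norm (w z) < 1"
  obtains g where "g holomorphic_on unit_disc" "\<And>z. z \<in> unit_disc \<Longrightarrow> norm (g z) \<le> 1"
    "\<And>z. z \<in> unit_disc \<Longrightarrow> w z = z * g z"
proof -
  obtain g where g: "g holomorphic_on unit_disc" "\<And>z. norm z < 1 \<Longrightarrow> w z = z * g z"
    and d: "deriv w 0 = g 0"
    using Schwarz3[OF hol w0] by metis
  have lt': "norm (w z) < 1" if "norm z < 1" for z
    using lt that by auto
  have "norm (g z) \<le> 1" if z: "norm z < 1" for z
  proof (cases "z = 0")
    case True
    then show ?thesis using Schwarz_Lemma(2)[OF hol w0 lt' z] d by simp
  next
    case False
    have "norm z * norm (g z) \<le> norm z * 1"
      using Schwarz_Lemma(1)[OF hol w0 lt' z] g(2)[OF z] by (simp add: norm_mult)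
    then show ?thesis using False by simp
  qed
  then show ?thesis
    using g by (intro that[of g]) auto
qed

text \<open>This is the disc automorphism that moves \<open>a\<close> to 0. It rests on the identity
  |1 - cnj(a) u|^2 - |u - a|^2 = (1 - |a|^2)(1 - |u|^2).\<close>

lemma norm_Moebius_less_1:
  fixes a u :: complex
  assumes "norm a < 1" "norm u < 1"
  shows "1 - cnj a * u \<noteq> 0" and "norm ((u - a) / (1 - cnj a * u)) < 1"
proof -
  have "norm (cnj a * u) < 1"
    using mult_strict_mono'[OF assms norm_ge_zero norm_ge_zero] by (simp add: norm_mult)
  then show nz: "1 - cnj a * u \<noteq> 0" by auto
  have "(norm (1 - cnj a * u))\<^sup>2 - (norm (u - a))\<^sup>2 = (1 - (norm a)\<^sup>2) * (1 - (norm u)\<^sup>2)"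
    by (simp add: cmod_power2) (simp add: power2_eq_square algebra_simps)
  moreover have "(1 - (norm a)\<^sup>2) * (1 - (norm u)\<^sup>2) > 0"
    using assms by (simp add: abs_square_less_1)
  ultimately have "(norm (u - a))\<^sup>2 < (norm (1 - cnj a * u))\<^sup>2" by simp
  then have "norm (u - a) < norm (1 - cnj a * u)"
    using power2_less_imp_less norm_ge_zero by blast
  then show "norm ((u - a) / (1 - cnj a * u)) < 1"
    using nz by (simp add: norm_divide)
qed

text \<open>The Moebius map moving \<open>g 0\<close> to 0 turns \<open>g\<close> into a Schwarz
  function, and \<open>h\<close> is its quotient by z. The relation is stated without division so
  that it also covers a unimodular \<open>g 0\<close>: then \<open>g\<close> is constant and
  \<open>h\<close> = 0 serves.\<close>

lemma Schur_step:
  assumes hol: "g holomorphic_on unit_disc" and le: "\<And>z. z \<in> unit_disc \<Longrightarrow> norm (g z) \<le> 1"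
  obtains h where "h holomorphic_on unit_disc" "\<And>z. z \<in> unit_disc \<Longrightarrow> norm (h z) \<le> 1"
    "\<And>z. z \<in> unit_disc \<Longrightarrow> g z - g 0 = z * h z * (1 - cnj (g 0) * g z)"
proof (cases "norm (g 0) = 1")
  case True
  then have "g z = g 0" if "z \<in> unit_disc" for z
    using bounded_by_center_imp_constant[OF hol le, of 0 z] that by auto
  then have "g z - g 0 = z * 0 * (1 - cnj (g 0) * g z)" if "z \<in> unit_disc" for z
    using that by (metis diff_self mult_zero_left mult_zero_right)
  then show ?thesis
    by (rule that[of "\<lambda>_. 0", rotated 2]) simp_all
next
  case False
  then have g0: "norm (g 0) < 1" using le[of 0] by simp
  \<comment> \<open>A value of modulus 1 at any interior point would make \<open>g\<close> constant,
    and so give \<open>g 0\<close> modulus 1 as well.\<close>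
  have lt: "norm (g z) < 1" if z: "z \<in> unit_disc" for z
  proof (rule ccontr)
    assume "\<not> norm (g z) < 1"
    then have "norm (g z) = 1" using le[OF z] by simp
    then show False
      using bounded_by_center_imp_constant[OF hol le z, of 0] False by auto
  qed
  define \<phi> where "\<phi> z = (g z - g 0) / (1 - cnj (g 0) * g z)" for z
  have "\<phi> holomorphic_on unit_disc"
    unfolding \<phi>_def using hol norm_Moebius_less_1(1)[OF g0 lt] by (auto intro!: holomorphic_intros)
  moreover have "\<phi> 0 = 0" by (simp add: \<phi>_def)
  moreover have "norm (\<phi> z) < 1" if "z \<in> unit_disc" for z
    unfolding \<phi>_def using norm_Moebius_less_1(2)[OF g0 lt[OF that]] .
  ultimately obtain h where h: "h holomorphic_on unit_disc"
      "\<And>z. z \<in> unit_disc \<Longrightarrow> norm (h z) \<le> 1" "\<And>z. z \<in> unit_disc \<Longrightarrow> \<phi> z = z * h z"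
    using Schwarz_quotient[of \<phi>] by metis
  have "g z - g 0 = z * h z * (1 - cnj (g 0) * g z)" if z: "z \<in> unit_disc" for z
    using h(3)[OF z] norm_Moebius_less_1(1)[OF g0 lt[OF z]]
    by (metis \<phi>_def nonzero_divide_eq_eq)
  with h show ?thesis by (intro that[of h]) auto
qed

section \<open>Taylor coefficients of a Schwarz function through Schur parameters\<close>

lemma fps_expansion_holomorphic:
  assumes "g holomorphic_on unit_disc"
  shows "g has_fps_expansion fps_expansion g 0"
  using assms by (intro has_fps_expansion_fps_expansion[of unit_disc]) auto

text \<open>Turns a functional equation on the disc into an identity of formal power series, whose
  coefficients can then be compared.\<close>

lemma has_fps_expansion_unique_on_disc:
  fixes f g :: "complex \<Rightarrow> complex"
  assumes "f has_fps_expansion F" "g has_fps_expansion G"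
    and "\<And>z. z \<in> unit_disc \<Longrightarrow> f z = g z"
  shows "F = G"
proof -
  have "eventually (\<lambda>z. z \<in> unit_disc) (nhds (0::complex))"
    by (intro eventually_nhds_in_open) auto
  then have "eventually (\<lambda>z. f z = g z) (nhds 0)"
    by eventually_elim (use assms(3) in auto)
  then have "g has_fps_expansion F"
    using assms(1) has_fps_expansion_cong by blast
  then show ?thesis using assms(2) fps_expansion_unique_complex by blast
qed

text \<open>The parameters are the values at 0 of the successive Schur functions \<open>g\<close>,
  \<open>h\<close>, \<open>k\<close>. In the last clause |b| = 1 makes \<open>h\<close> constant by
  the maximum principle, and with \<open>a\<close> = 0 the first Schur relation becomes g(z) = b
  z.\<close>

lemma Schwarz_coeffs:
  assumes w: "w holomorphic_on unit_disc" "w 0 = 0" "\<And>z. z \<in> unit_disc \<Longrightarrow> norm (w z) < 1"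
  obtains a b d where "norm a \<le> 1" "norm b \<le> 1" "norm d \<le> 1"
    "fps_nth (fps_expansion w 0) 1 = a"
    "fps_nth (fps_expansion w 0) 2 = (1 - of_real ((norm a)\<^sup>2)) * b"
    "fps_nth (fps_expansion w 0) 3 =
       (1 - of_real ((norm a)\<^sup>2)) * ((1 - of_real ((norm b)\<^sup>2)) * d - cnj a * b\<^sup>2)"
    "a = 0 \<Longrightarrow> norm b = 1 \<Longrightarrow> \<forall>z\<in>unit_disc. w z = b * z\<^sup>2"
proof -
  obtain g where g: "g holomorphic_on unit_disc" "\<And>z. z \<in> unit_disc \<Longrightarrow> norm (g z) \<le> 1"
    "\<And>z. z \<in> unit_disc \<Longrightarrow> w z = z * g z"
    using Schwarz_quotient[OF w] by metis
  obtain h where h: "h holomorphic_on unit_disc" "\<And>z. z \<in> unit_disc \<Longrightarrow> norm (h z) \<le> 1"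
    "\<And>z. z \<in> unit_disc \<Longrightarrow> g z - g 0 = z * h z * (1 - cnj (g 0) * g z)"
    using Schur_step[OF g(1,2)] by metis
  obtain k where k: "k holomorphic_on unit_disc" "\<And>z. z \<in> unit_disc \<Longrightarrow> norm (k z) \<le> 1"
    "\<And>z. z \<in> unit_disc \<Longrightarrow> h z - h 0 = z * k z * (1 - cnj (h 0) * h z)"
    using Schur_step[OF h(1,2)] by metis
  define W G H K where "W = fps_expansion w 0" and "G = fps_expansion g 0"
    and "H = fps_expansion h 0" and "K = fps_expansion k 0"
  have e: "w has_fps_expansion W" "g has_fps_expansion G" "h has_fps_expansion H"
      "k has_fps_expansion K"
    unfolding W_def G_def H_def K_def using w g h k by (auto intro!: fps_expansion_holomorphic)
  have z: "g 0 = fps_nth G 0" "h 0 = fps_nth H 0" "k 0 = fps_nth K 0"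
    using e has_fps_expansion_imp_0_eq_fps_nth_0 by blast+
  have WG: "W = fps_X * G"
    by (rule has_fps_expansion_unique_on_disc[OF e(1), of "\<lambda>z. z * g z"])
       (use e g(3) in \<open>auto intro!: fps_expansion_intros\<close>)
  have GH: "G - fps_const (g 0) = fps_X * H * (1 - fps_const (cnj (g 0)) * G)"
    by (rule has_fps_expansion_unique_on_disc[of "\<lambda>z. g z - g 0" _
          "\<lambda>z. z * h z * (1 - cnj (g 0) * g z)"])
       (use e h(3) in \<open>auto intro!: fps_expansion_intros\<close>)
  have HK: "H - fps_const (h 0) = fps_X * K * (1 - fps_const (cnj (h 0)) * H)"
    by (rule has_fps_expansion_unique_on_disc[of "\<lambda>z. h z - h 0" _
          "\<lambda>z. z * k z * (1 - cnj (h 0) * h z)"])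
       (use e k(3) in \<open>auto intro!: fps_expansion_intros\<close>)
  define a b d where "a = g 0" and "b = h 0" and "d = k 0"
  have sq: "of_real ((norm u)\<^sup>2) = cnj u * u" for u
    by (metis complex_norm_square mult.commute)
  have H1: "fps_nth H 1 = (1 - of_real ((norm b)\<^sup>2)) * d"
    using arg_cong[OF HK, of "\<lambda>F. fps_nth F 1"]
    unfolding sq by (simp add: fps_mult_nth z[symmetric] a_def b_def d_def)
  have G1: "fps_nth G 1 = (1 - of_real ((norm a)\<^sup>2)) * b"
    using arg_cong[OF GH, of "\<lambda>F. fps_nth F 1"]
    unfolding sq by (simp add: fps_mult_nth z[symmetric] a_def b_def d_def)
  \<comment> \<open>The factor \<open>fps_X\<close> shifts degrees: only coefficients 0 and 1 of
    \<open>H\<close> and of 1 - cnj(a) G contribute.\<close>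
  have "fps_nth G 2 = fps_nth H 1 * (1 - cnj a * a) - b * cnj a * fps_nth G 1"
    using arg_cong[OF GH, of "\<lambda>F. fps_nth F 2"]
    by (simp add: fps_mult_nth numeral_eq_Suc z[symmetric] a_def b_def d_def algebra_simps)
  then have G2: "fps_nth G 2 =
      (1 - of_real ((norm a)\<^sup>2)) * ((1 - of_real ((norm b)\<^sup>2)) * d - cnj a * b\<^sup>2)"
    unfolding H1 G1 sq by (simp add: algebra_simps power2_eq_square)
  show ?thesis
  proof (rule that[of a b d])
    show "norm a \<le> 1" "norm b \<le> 1" "norm d \<le> 1"
      using g(2) h(2) k(2) by (auto simp: a_def b_def d_def)
    show "fps_nth (fps_expansion w 0) 1 = a"
      using WG by (simp add: W_def[symmetric] a_def z)
    show "fps_nth (fps_expansion w 0) 2 = (1 - of_real ((norm a)\<^sup>2)) * b"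
      using WG G1 by (simp add: W_def[symmetric] numeral_eq_Suc)
    show "fps_nth (fps_expansion w 0) 3 =
       (1 - of_real ((norm a)\<^sup>2)) * ((1 - of_real ((norm b)\<^sup>2)) * d - cnj a * b\<^sup>2)"
      using WG G2 by (simp add: W_def[symmetric] numeral_eq_Suc)
    assume ab: "a = 0" "norm b = 1"
    show "\<forall>z\<in>unit_disc. w z = b * z\<^sup>2"
    proof
      fix z :: complex assume zz: "z \<in> unit_disc"
      have "h z = b"
        using bounded_by_center_imp_constant[OF h(1,2), of 0 z] zz ab by (simp add: b_def)
      then show "w z = b * z\<^sup>2"
        using g(3)[OF zz] h(3)[OF zz] ab by (simp add: a_def power2_eq_square)
    qed
  qed
qed

section \<open>Sharp bound for the coefficient functional\<close>

definition schwarz_functional :: "complex fps \<Rightarrow> complex" where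
  "schwarz_functional W = 4 * fps_nth W 1 * fps_nth W 3 + 2 * (fps_nth W 1)\<^sup>2 * fps_nth W 2
     + (fps_nth W 1) ^ 4 - 3 * (fps_nth W 2)\<^sup>2"

text \<open>Here x = |a| and s = |b|. The right side is the value of the left side at s = 1, so the
  difference vanishes there and splits into products of nonnegative factors.\<close>

lemma Schur_parameter_bound:
  fixes x s :: real
  assumes x: "0 \<le> x" "x \<le> 1" and s: "0 \<le> s" "s \<le> 1"
  shows "4 * x * ((1 - x\<^sup>2) * ((1 - s\<^sup>2) + x * s\<^sup>2)) + 2 * x\<^sup>2 * ((1 - x\<^sup>2) * s) + x ^ 4
    + 3 * ((1 - x\<^sup>2) * s)\<^sup>2 \<le> 3 - 2 * x ^ 4" (is "?L \<le> ?R")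
proof -
  have "?R - ?L = (1 - x\<^sup>2) * (1 - x) * (3 - x) * (1 - s\<^sup>2) + 2 * x\<^sup>2 * (1 - x\<^sup>2) * (1 - s)"
    by (simp add: power2_eq_square power4_eq_xxxx algebra_simps)
  also have "\<dots> \<ge> 0"
    using x s by (intro add_nonneg_nonneg mult_nonneg_nonneg) (auto simp: power_le_one)
  finally show ?thesis by simp
qed

text \<open>The estimate actually proved is 3 - 2 |a|^4; the surplus term is what settles the
  equality case.\<close>

lemma schwarz_functional_bound:
  assumes w: "w holomorphic_on unit_disc" "w 0 = 0" "\<And>z. z \<in> unit_disc \<Longrightarrow> norm (w z) < 1"
  shows "norm (schwarz_functional (fps_expansion w 0)) \<le> 3"
    and "norm (schwarz_functional (fps_expansion w 0)) = 3 \<Longrightarrow>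
      \<exists>b. norm b = 1 \<and> (\<forall>z\<in>unit_disc. w z = b * z\<^sup>2)"
proof -
  obtain a b d where n: "norm a \<le> 1" "norm b \<le> 1" "norm d \<le> 1"
    and c1: "fps_nth (fps_expansion w 0) 1 = a"
    and c2: "fps_nth (fps_expansion w 0) 2 = (1 - of_real ((norm a)\<^sup>2)) * b"
    and c3: "fps_nth (fps_expansion w 0) 3 =
       (1 - of_real ((norm a)\<^sup>2)) * ((1 - of_real ((norm b)\<^sup>2)) * d - cnj a * b\<^sup>2)"
    and ex: "a = 0 \<Longrightarrow> norm b = 1 \<Longrightarrow> \<forall>z\<in>unit_disc. w z = b * z\<^sup>2"
    using Schwarz_coeffs[OF w] by metis
  define x s where "x = norm a" and "s = norm b"
  have xs: "0 \<le> x" "x \<le> 1" "0 \<le> s" "s \<le> 1" using n by (auto simp: x_def s_def)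
  define u where "u t = (1 - of_real (t\<^sup>2) :: complex)" for t :: real
  have u: "norm (u t) = 1 - t\<^sup>2" if "0 \<le> t" "t \<le> 1" for t
  proof -
    have "u t = of_real (1 - t\<^sup>2)" by (simp add: u_def)
    then show ?thesis using that by (simp only: norm_of_real) (simp add: power_le_one)
  qed
  define S where "S = schwarz_functional (fps_expansion w 0)"
  have S: "S = 4 * a * (u x * (u s * d - cnj a * b\<^sup>2)) + 2 * a\<^sup>2 * (u x * b) + a ^ 4
      - 3 * (u x * b)\<^sup>2"
    unfolding S_def schwarz_functional_def c1 c2 c3 by (simp add: u_def x_def s_def)
  \<comment> \<open>This is the only place where the third parameter \<open>d\<close> enters; |d|
    \<le> 1 eliminates it.\<close>
  have d3: "norm (u s * d - cnj a * b\<^sup>2) \<le> (1 - s\<^sup>2) + x * s\<^sup>2"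
  proof -
    have "norm (u s * d - cnj a * b\<^sup>2) \<le> norm (u s * d) + norm (cnj a * b\<^sup>2)"
      by (rule norm_triangle_ineq4)
    also have "norm (u s * d) \<le> (1 - s\<^sup>2) * 1"
      unfolding norm_mult u[OF xs(3,4)] using n xs by (intro mult_left_mono) (auto simp: power_le_one)
    also have "norm (cnj a * b\<^sup>2) = x * s\<^sup>2"
      by (simp add: norm_mult norm_power x_def s_def)
    finally show ?thesis by simp
  qed
  have "norm S \<le> norm (4 * a * (u x * (u s * d - cnj a * b\<^sup>2))) + norm (2 * a\<^sup>2 * (u x * b))
      + norm (a ^ 4) + norm (3 * (u x * b)\<^sup>2)"
    unfolding S
    by (intro order_trans[OF norm_triangle_ineq4] add_mono order_trans[OF norm_triangle_ineq]) auto
  also have "\<dots> = 4 * x * ((1 - x\<^sup>2) * norm (u s * d - cnj a * b\<^sup>2)) + 2 * x\<^sup>2 * ((1 - x\<^sup>2) * s) + x ^ 4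
    + 3 * ((1 - x\<^sup>2) * s)\<^sup>2"
    by (simp add: norm_mult norm_power u[OF xs(1,2)]) (simp add: x_def s_def)
  also have "\<dots> \<le> 4 * x * ((1 - x\<^sup>2) * ((1 - s\<^sup>2) + x * s\<^sup>2)) + 2 * x\<^sup>2 * ((1 - x\<^sup>2) * s) + x ^ 4
    + 3 * ((1 - x\<^sup>2) * s)\<^sup>2"
    using d3 xs by (intro add_mono mult_left_mono) (auto simp: power_le_one)
  also have "\<dots> \<le> 3 - 2 * x ^ 4"
    by (rule Schur_parameter_bound) (use xs in auto)
  finally have b: "norm S \<le> 3 - 2 * x ^ 4" .
  moreover have "x ^ 4 \<ge> 0" using xs by simp
  ultimately show "norm (schwarz_functional (fps_expansion w 0)) \<le> 3"
    unfolding S_def[symmetric] by linarith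
  assume "norm (schwarz_functional (fps_expansion w 0)) = 3"
  then have S3: "norm S = 3" by (simp add: S_def)
  then have "x ^ 4 \<le> 0" using b by simp
  then have "x ^ 4 = 0" using \<open>x ^ 4 \<ge> 0\<close> by linarith
  then have a0: "a = 0" by (simp add: x_def)
  \<comment> \<open>With \<open>a\<close> = 0 every term except the last vanishes, and
    \<open>u x\<close> has modulus 1.\<close>
  then have "norm S = 3 * s\<^sup>2"
    using S u[OF xs(1,2)] by (simp add: norm_mult norm_power x_def s_def)
  then have "s\<^sup>2 = 1" using S3 by simp
  then have "norm b = 1" using xs(3) by (simp add: s_def power2_eq_iff_nonneg[of _ 1, simplified])
  then show "\<exists>b. norm b = 1 \<and> (\<forall>z\<in>unit_disc. w z = b * z\<^sup>2)"
    using ex[OF a0] by blast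
qed

section \<open>The Hankel determinant in terms of Schwarz coefficients\<close>

text \<open>Solving the equation degree by degree gives, for the halved coefficients of
  \<open>F\<close>, the values c w1, c (w2 + w1^2) / 2 and c (w3 + 2 w1 w2 + w1^3) / 3. All are
  linear in \<open>c\<close>, so \<open>c\<close> leaves the determinant as the factor c^2.\<close>

lemma hankel_Schwarz_coeffs:
  fixes c :: complex
  assumes F: "F holomorphic_on unit_disc" and w: "w holomorphic_on unit_disc" "w 0 = 0"
    and eq: "\<And>z. z \<in> unit_disc \<Longrightarrow> z * deriv F z * (1 - w z) = 2 * c * w z"
  shows "(fps_nth (fps_expansion F 0) 1 / 2) * (fps_nth (fps_expansion F 0) 3 / 2)
      - (fps_nth (fps_expansion F 0) 2 / 2)\<^sup>2
    = c\<^sup>2 / 12 * schwarz_functional (fps_expansion w 0)"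
proof -
  define L W where "L = fps_expansion F 0" and "W = fps_expansion w 0"
  have e: "F has_fps_expansion L" "w has_fps_expansion W"
    unfolding L_def W_def using F w by (auto intro!: fps_expansion_holomorphic)
  have W0: "fps_nth W 0 = 0"
    using has_fps_expansion_imp_0_eq_fps_nth_0[OF e(2)] w by simp
  have LW: "fps_X * fps_deriv L * (1 - W) = fps_const (2 * c) * W"
    by (rule has_fps_expansion_unique_on_disc[of "\<lambda>z. z * deriv F z * (1 - w z)" _
          "\<lambda>z. (2 * c) * w z"])
       (use e eq in \<open>auto intro!: fps_expansion_intros\<close>)
  have L1: "fps_nth L 1 = 2 * c * fps_nth W 1"
    using arg_cong[OF LW, of "\<lambda>F. fps_nth F 1"]
    by (simp add: fps_mult_nth numeral_eq_Suc W0)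
  have L2: "2 * fps_nth L 2 = 2 * c * fps_nth W 2 + fps_nth L 1 * fps_nth W 1"
    using arg_cong[OF LW, of "\<lambda>F. fps_nth F 2"]
    by (simp add: fps_mult_nth numeral_eq_Suc W0 algebra_simps)
  have L3: "3 * fps_nth L 3 = 2 * c * fps_nth W 3 + 2 * fps_nth L 2 * fps_nth W 1
      + fps_nth L 1 * fps_nth W 2"
    using arg_cong[OF LW, of "\<lambda>F. fps_nth F 3"]
    by (simp add: fps_mult_nth numeral_eq_Suc W0 algebra_simps)
  have L2': "fps_nth L 2 = c * fps_nth W 2 + c * (fps_nth W 1)\<^sup>2"
  proof -
    have "2 * fps_nth L 2 = 2 * (c * fps_nth W 2 + c * (fps_nth W 1)\<^sup>2)"
      unfolding L2 L1 by (simp add: power2_eq_square algebra_simps)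
    then show ?thesis by (metis mult_cancel_left zero_neq_numeral)
  qed
  have L3': "fps_nth L 3 = (2 * c * fps_nth W 3 + 2 * fps_nth L 2 * fps_nth W 1
      + fps_nth L 1 * fps_nth W 2) / 3"
    using L3 by (simp add: eq_divide_eq mult.commute)
  show ?thesis
    unfolding L_def[symmetric] W_def[symmetric] schwarz_functional_def L3' L2' L1
    by (simp add: field_simps power2_eq_square power4_eq_xxxx)
qed

text \<open>Serves both directions of the theorem: with the Schwarz function of a given spirallike
  \<open>f\<close>, and with w(z) = b z^2 when \<open>f\<close> is a rotation of the extremal
  function.\<close>

lemma log_hankel_Schwarz:
  assumes "is_log_ratio f (log_ratio f)"
    and "w holomorphic_on unit_disc" "w 0 = 0"
    and "\<And>z. z \<in> unit_disc \<Longrightarrow> z * deriv (log_ratio f) z * (1 - w z) = 2 * c * w z"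
  shows "log_hankel_2_1 f = c\<^sup>2 / 12 * schwarz_functional (fps_expansion w 0)"
  unfolding log_hankel_2_1_def log_coeff_def
  by (rule hankel_Schwarz_coeffs) (use assms in \<open>auto simp: is_log_ratio_def\<close>)

section \<open>From spirallikeness to a Schwarz function\<close>

lemma log_ratio_deriv:
  assumes f: "f \<in> class_A" and F: "is_log_ratio f F" and z: "z \<in> unit_disc" "z \<noteq> 0"
  shows "z * deriv f z / f z = 1 + z * deriv F z"
proof -
  have hol: "F holomorphic_on unit_disc" using F by (simp add: is_log_ratio_def)
  have ex: "f u = u * exp (F u)" if "u \<in> unit_disc" for u
    using f F that by (cases "u = 0") (auto simp: class_A_def is_log_ratio_def)
  have "(F has_field_derivative deriv F z) (at z)"
    using holomorphic_derivI[OF hol open_ball z(1)] .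
  then have "((\<lambda>u. u * exp (F u)) has_field_derivative exp (F z) * (1 + z * deriv F z)) (at z)"
    by (auto intro!: derivative_eq_intros simp: algebra_simps)
  then have "(f has_field_derivative exp (F z) * (1 + z * deriv F z)) (at z)"
    by (rule has_field_derivative_transform_within_open[OF _ open_ball z(1)]) (simp add: ex)
  then have "deriv f z = exp (F z) * (1 + z * deriv F z)" by (rule DERIV_imp_deriv)
  then show ?thesis using z by (simp add: ex)
qed

text \<open>The reason is |p + 1|^2 - |p - 1|^2 = 4 Re p.\<close>

lemma Cayley_norm_less_1:
  fixes p :: complex
  assumes "Re p > 0"
  shows "p + 1 \<noteq> 0" "norm ((p - 1) / (p + 1)) < 1"
proof -
  show nz: "p + 1 \<noteq> 0" using assms by (auto simp: complex_eq_iff)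
  have "(norm (p - 1))\<^sup>2 < (norm (p + 1))\<^sup>2"
    using assms by (simp add: cmod_power2) (simp add: power2_eq_square algebra_simps)
  then have "norm (p - 1) < norm (p + 1)"
    using power2_less_imp_less norm_ge_zero by blast
  then show "norm ((p - 1) / (p + 1)) < 1" using nz by (simp add: norm_divide)
qed

text \<open>Multiplication by \<open>cis (- \<beta>)\<close> makes \<open>c\<close> the real number
  r = cos \<beta> - \<alpha> cos \<beta>. With z F' = c (p - 1) the spirallike condition therefore
  reads r Re p > 0. The Cayley transform w = (p - 1)/(p + 1) then satisfies p - 1 = 2 w / (1 - w),
  which is the stated equation.\<close>

lemma spirallike_Schwarz_function:
  assumes \<beta>: "cos \<beta> > 0" and \<alpha>: "\<alpha> < 1" and f: "f \<in> spirallike \<beta> \<alpha>" and F: "is_log_ratio f F"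
  obtains w where "w holomorphic_on unit_disc" "w 0 = 0" "\<And>z. z \<in> unit_disc \<Longrightarrow> norm (w z) < 1"
    "\<And>z. z \<in> unit_disc \<Longrightarrow>
      z * deriv F z * (1 - w z) = 2 * (of_real ((1 - \<alpha>) * cos \<beta>) * cis \<beta>) * w z"
proof -
  define r c where "r = (1 - \<alpha>) * cos \<beta>" and "c = of_real r * cis \<beta>"
  have r: "r > 0" using \<alpha> \<beta> by (simp add: r_def)
  then have c: "c \<noteq> 0" by (simp add: c_def)
  define p where "p z = 1 + z * deriv F z / c" for z
  have Rep: "Re (p z) > 0" if z: "z \<in> unit_disc" for z
  proof -
    have fA: "f \<in> class_A" using f by (simp add: spirallike_def)
    have "(if z = 0 then 1 else z * deriv f z / f z) = 1 + z * deriv F z"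
      using log_ratio_deriv[OF fA F z] by auto
    then have "Re (cis (- \<beta>) * (1 + z * deriv F z)) > \<alpha> * cos \<beta>"
      using f z unfolding spirallike_def by force
    moreover have "cis (- \<beta>) * (1 + z * deriv F z) = cis (- \<beta>) + of_real r * (p z - 1)"
    proof -
      have "z * deriv F z = c * (p z - 1)" using c by (simp add: p_def)
      moreover have "cis (- \<beta>) * c = of_real r"
        by (simp add: c_def cis_mult)
      ultimately show ?thesis by (metis distrib_left mult.assoc mult.right_neutral)
    qed
    ultimately have "cos \<beta> + r * (Re (p z) - 1) > \<alpha> * cos \<beta>" by simp
    then have "r * Re (p z) > 0" by (simp add: r_def algebra_simps)
    then show ?thesis using r by (simp add: zero_less_mult_iff)
  qed
  define w where "w z = (p z - 1) / (p z + 1)" for z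
  have "F holomorphic_on unit_disc" using F by (simp add: is_log_ratio_def)
  then have "p holomorphic_on unit_disc"
    unfolding p_def using c by (auto intro!: holomorphic_intros)
  then have "w holomorphic_on unit_disc"
    unfolding w_def using Cayley_norm_less_1(1)[OF Rep] by (auto intro!: holomorphic_intros)
  moreover have "w 0 = 0" by (simp add: w_def p_def)
  moreover have "norm (w z) < 1" if "z \<in> unit_disc" for z
    unfolding w_def using Cayley_norm_less_1(2)[OF Rep[OF that]] .
  moreover have "z * deriv F z * (1 - w z) = 2 * c * w z" if z: "z \<in> unit_disc" for z
  proof -
    have "z * deriv F z = c * (p z - 1)" using c by (simp add: p_def)
    moreover have "1 - w z = 2 / (p z + 1)"
      using Cayley_norm_less_1(1)[OF Rep[OF z]] by (simp add: w_def divide_simps)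
    ultimately show ?thesis by (simp add: w_def)
  qed
  ultimately show ?thesis by (intro that[of w]) (auto simp: c_def r_def)
qed

section \<open>The extremal function, its rotations and their logarithms\<close>

lemma Re_one_minus_square_pos:
  fixes b z :: complex
  assumes "norm b = 1" "z \<in> unit_disc"
  shows "Re (1 - b * z\<^sup>2) > 0" and "1 - b * z\<^sup>2 \<noteq> 0" and "1 - b * z\<^sup>2 \<notin> \<real>\<^sub>\<le>\<^sub>0"
proof -
  have "norm (b * z\<^sup>2) < 1"
    using assms by (simp add: norm_mult norm_power power_less_one_iff abs_square_less_1)
  then have "Re (b * z\<^sup>2) < 1" using complex_Re_le_cmod le_less_trans by blast
  then show "Re (1 - b * z\<^sup>2) > 0" by simp
  then show "1 - b * z\<^sup>2 \<noteq> 0" "1 - b * z\<^sup>2 \<notin> \<real>\<^sub>\<le>\<^sub>0"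
    by (metis less_irrefl zero_complex.sel(1)) (metis complex_nonpos_Reals_iff not_less \<open>Re (1 - b * z\<^sup>2) > 0\<close>)
qed

text \<open>Rotating by \<theta> changes only z^2, into \<open>cis (2 * \<theta>)\<close> z^2, so
  the rotations form a family indexed by the unimodular number b =
  \<open>cis (2 * \<theta>)\<close>.\<close>

lemma rotated_extremal_eq:
  assumes "z \<in> unit_disc"
  shows "cis (- \<theta>) * extremal_f1 \<alpha> \<beta> (cis \<theta> * z) =
    z * exp (- (of_real ((1 - \<alpha>) * cos \<beta>) * cis \<beta>) * Ln (1 - cis (2 * \<theta>) * z\<^sup>2))"
proof -
  have sq: "(cis \<theta> * z)\<^sup>2 = cis (2 * \<theta>) * z\<^sup>2"
    by (simp add: power_mult_distrib Complex.DeMoivre)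
  have nz: "1 - cis (2 * \<theta>) * z\<^sup>2 \<noteq> 0"
    using Re_one_minus_square_pos(2)[of "cis (2 * \<theta>)" z] assms by simp
  have "cis (- \<theta>) * (cis \<theta> * z / u) = z * inverse u" for u
    by (simp add: mult.assoc[symmetric] cis_mult divide_inverse)
  then show ?thesis
    using nz unfolding extremal_f1_def sq powr_def mult_minus_left exp_minus by simp
qed

lemma deriv_log_one_minus_square:
  fixes b c z :: complex
  assumes "norm b = 1" "z \<in> unit_disc"
  shows "((\<lambda>z. - c * Ln (1 - b * z\<^sup>2)) has_field_derivative 2 * c * b * z / (1 - b * z\<^sup>2)) (at z)"
  using Re_one_minus_square_pos[OF assms]
  by (auto intro!: derivative_eq_intros simp: field_simps)

text \<open>Integrates the differential equation in the equality case w(z) = b z^2;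
  \<open>F 0 = 0\<close> fixes the constant.\<close>

lemma log_ratio_eq_of_Schwarz_square:
  fixes b c :: complex
  assumes F: "F holomorphic_on unit_disc" "F 0 = 0" and b: "norm b = 1"
    and eq: "\<And>z. z \<in> unit_disc \<Longrightarrow> z * deriv F z * (1 - b * z\<^sup>2) = 2 * c * (b * z\<^sup>2)"
    and z: "z \<in> unit_disc"
  shows "F z = - c * Ln (1 - b * z\<^sup>2)"
proof -
  define D where "D u = F u - (- c * Ln (1 - b * u\<^sup>2))" for u
  have dD: "(D has_field_derivative deriv F u - 2 * c * b * u / (1 - b * u\<^sup>2)) (at u)"
    if "u \<in> unit_disc" for u
    unfolding D_def
    by (rule DERIV_diff[OF holomorphic_derivI[OF F(1) open_ball that]
          deriv_log_one_minus_square[OF b that]])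
  have "deriv F u - 2 * c * b * u / (1 - b * u\<^sup>2) = 0" if u: "u \<in> unit_disc - {0}" for u
  proof -
    have "u * (deriv F u * (1 - b * u\<^sup>2)) = u * (2 * c * b * u)"
      using eq[of u] u by (simp add: power2_eq_square mult_ac)
    then have "deriv F u * (1 - b * u\<^sup>2) = 2 * c * b * u" using u by simp
    then show ?thesis
      using Re_one_minus_square_pos(2)[OF b, of u] u by (simp add: eq_divide_eq)
  qed
  \<comment> \<open>Cancelling u left out the origin; continuity of \<open>D\<close> lets the
    constancy criterion tolerate this exceptional point.\<close>
  then have "\<forall>u\<in>unit_disc - {0}. (D has_field_derivative 0) (at u)"
    using dD by fastforce
  moreover have "continuous_on unit_disc D"
    using DERIV_continuous_on[OF has_field_derivative_at_within[OF dD]] .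
  ultimately have "D constant_on unit_disc"
    by (intro DERIV_zero_connected_constant_on[of unit_disc "{0}"]) auto
  then obtain k where k: "\<And>u. u \<in> unit_disc \<Longrightarrow> D u = k"
    unfolding constant_on_def by blast
  have "D z = D 0" using k[OF z] k[of 0] by simp
  then show ?thesis using F by (simp add: D_def eq_neg_iff_add_eq_0)
qed

section \<open>The sharp estimate and its equality case\<close>

theorem theorem3p1:
  fixes \<alpha> \<beta> :: real and f :: "complex \<Rightarrow> complex"
  assumes "- pi / 2 < \<beta>" and "\<beta> < pi / 2"
    and "0 \<le> \<alpha>" and "\<alpha> < 1"
    and "f \<in> spirallike \<beta> \<alpha>"
  shows "norm (log_hankel_2_1 f) \<le> (1 - \<alpha>)\<^sup>2 * (cos \<beta>)\<^sup>2 / 4 \<and>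
    (norm (log_hankel_2_1 f) = (1 - \<alpha>)\<^sup>2 * (cos \<beta>)\<^sup>2 / 4
       \<longleftrightarrow> is_rotation_of f (extremal_f1 \<alpha> \<beta>))"
proof -
  have cos: "cos \<beta> > 0" using assms by (intro cos_gt_zero_pi) auto
  define c where "c = of_real ((1 - \<alpha>) * cos \<beta>) * cis \<beta>"
  have nc: "norm (c\<^sup>2 / 12) = (1 - \<alpha>)\<^sup>2 * (cos \<beta>)\<^sup>2 / 12"
    unfolding c_def norm_divide norm_power norm_mult norm_of_real norm_cis
    by (simp add: power_mult_distrib)
  have pos: "(1 - \<alpha>)\<^sup>2 * (cos \<beta>)\<^sup>2 > 0" using cos assms by simp
  have f: "f \<in> class_A" "\<And>z. z \<in> unit_disc - {0} \<Longrightarrow> f z \<noteq> 0"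
    using assms by (auto simp: spirallike_def)
  define F where "F = log_ratio f"
  have F: "is_log_ratio f F" unfolding F_def by (rule is_log_ratio_log_ratio[OF f])
  then have F': "F holomorphic_on unit_disc" "F 0 = 0"
      "\<And>z. z \<in> unit_disc - {0} \<Longrightarrow> exp (F z) = f z / z"
    by (auto simp: is_log_ratio_def)
  obtain w where w: "w holomorphic_on unit_disc" "w 0 = 0"
      "\<And>z. z \<in> unit_disc \<Longrightarrow> norm (w z) < 1"
    and wF: "\<And>z. z \<in> unit_disc \<Longrightarrow> z * deriv F z * (1 - w z) = 2 * c * w z"
    using spirallike_Schwarz_function[OF cos assms(4,5) F] unfolding c_def by metis
  have "log_hankel_2_1 f = c\<^sup>2 / 12 * schwarz_functional (fps_expansion w 0)"
    by (rule log_hankel_Schwarz[OF F[unfolded F_def] w(1,2) wF[unfolded F_def]])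
  then have H: "norm (log_hankel_2_1 f) =
      (1 - \<alpha>)\<^sup>2 * (cos \<beta>)\<^sup>2 / 12 * norm (schwarz_functional (fps_expansion w 0))"
    by (simp only: norm_mult nc)
  have "norm (log_hankel_2_1 f) \<le> (1 - \<alpha>)\<^sup>2 * (cos \<beta>)\<^sup>2 / 12 * 3"
    unfolding H using schwarz_functional_bound(1)[OF w] by (intro mult_left_mono) auto
  then have bound: "norm (log_hankel_2_1 f) \<le> (1 - \<alpha>)\<^sup>2 * (cos \<beta>)\<^sup>2 / 4" by linarith
  have "is_rotation_of f (extremal_f1 \<alpha> \<beta>)"
    if "norm (log_hankel_2_1 f) = (1 - \<alpha>)\<^sup>2 * (cos \<beta>)\<^sup>2 / 4"
  proof -
    \<comment> \<open>The factor in \<open>H\<close> is positive by \<open>pos\<close>, so it can be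
      cancelled.\<close>
    have "norm (schwarz_functional (fps_expansion w 0)) = 3"
      using that pos cos assms(4) unfolding H by (simp add: field_simps)
    then obtain b where b: "norm b = 1" "\<And>z. z \<in> unit_disc \<Longrightarrow> w z = b * z\<^sup>2"
      using schwarz_functional_bound(2)[OF w] by blast
    \<comment> \<open>Half the argument, because the rotation angle is doubled by the square in the
      extremal function.\<close>
    define \<theta> where "\<theta> = Arg b / 2"
    have "cis (2 * \<theta>) = b"
      using b(1) cis_Arg[of b] by (simp add: \<theta>_def sgn_div_norm)
        (metis norm_zero zero_neq_one sgn_div_norm div_by_1 inverse_1 scaleR_one)
    have "f z = cis (- \<theta>) * extremal_f1 \<alpha> \<beta> (cis \<theta> * z)" if z: "z \<in> unit_disc" for z
    proof -
      have "F z = - c * Ln (1 - b * z\<^sup>2)"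
        by (rule log_ratio_eq_of_Schwarz_square[OF F'(1,2) b(1) _ z]) (use wF b(2) in force)
      moreover have "f z = z * exp (F z)"
        using F'(3)[of z] z f(1) by (cases "z = 0") (auto simp: class_A_def)
      ultimately show ?thesis
        unfolding rotated_extremal_eq[OF z] \<open>cis (2 * \<theta>) = b\<close> c_def by simp
    qed
    then show ?thesis unfolding is_rotation_of_def by blast
  qed
  moreover have "norm (log_hankel_2_1 f) = (1 - \<alpha>)\<^sup>2 * (cos \<beta>)\<^sup>2 / 4"
    if rot: "is_rotation_of f (extremal_f1 \<alpha> \<beta>)"
  proof -
    obtain \<theta> where \<theta>: "\<forall>z\<in>unit_disc. f z = cis (- \<theta>) * extremal_f1 \<alpha> \<beta> (cis \<theta> * z)"
      using rot unfolding is_rotation_of_def by blast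
    have fz: "f z = z * exp (- c * Ln (1 - cis (2 * \<theta>) * z\<^sup>2))" if "z \<in> unit_disc" for z
      using that rotated_extremal_eq[OF that] \<theta> by (simp add: c_def)
    define b where "b = cis (2 * \<theta>)"
    have b: "norm b = 1" by (simp add: b_def)
    \<comment> \<open>The explicit logarithm read off from \<open>fz\<close>; uniqueness of the log
      ratio identifies it with \<open>F\<close> and so yields the differential equation with w(z) =
      b z^2.\<close>
    define G where "G z = - c * Ln (1 - b * z\<^sup>2)" for z
    have dG: "(G has_field_derivative 2 * c * b * z / (1 - b * z\<^sup>2)) (at z)"
      if "z \<in> unit_disc" for z
      unfolding G_def by (rule deriv_log_one_minus_square[OF b that])
    have "is_log_ratio f G"
      unfolding is_log_ratio_def
    proof (intro conjI ballI)
      show "G holomorphic_on unit_disc"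
        unfolding holomorphic_on_open[OF open_ball] using dG by blast
      show "G 0 = 0" by (simp add: G_def)
      show "exp (G z) = f z / z" if "z \<in> unit_disc - {0}" for z
        using fz[of z] that by (simp add: G_def b_def)
    qed
    then have FG: "F z = G z" if "z \<in> unit_disc" for z
      using is_log_ratio_unique[OF F] that by blast
    have "z * deriv F z * (1 - b * z\<^sup>2) = 2 * c * (b * z\<^sup>2)" if z: "z \<in> unit_disc" for z
    proof -
      have "(F has_field_derivative 2 * c * b * z / (1 - b * z\<^sup>2)) (at z)"
        by (rule has_field_derivative_transform_within_open[OF dG[OF z] open_ball z])
           (simp add: FG)
      then have "deriv F z = 2 * c * b * z / (1 - b * z\<^sup>2)" by (rule DERIV_imp_deriv)
      then show ?thesis
        using Re_one_minus_square_pos(2)[OF b z] by (simp add: power2_eq_square)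
    qed
    then have "log_hankel_2_1 f = c\<^sup>2 / 12 * schwarz_functional (fps_expansion (\<lambda>z. b * z\<^sup>2) 0)"
      by (intro log_hankel_Schwarz[OF F[unfolded F_def]])
         (auto simp: F_def intro!: holomorphic_intros)
    moreover have "fps_expansion (\<lambda>z. b * z\<^sup>2) 0 = fps_const b * fps_X ^ 2"
      by (intro fps_expansion_eqI fps_expansion_intros)
    \<comment> \<open>Only the second coefficient of b z^2 is nonzero, so just the term -3 w2^2
      survives.\<close>
    ultimately have "log_hankel_2_1 f = c\<^sup>2 / 12 * (- 3 * b\<^sup>2)"
      by (simp add: schwarz_functional_def)
    then have "norm (log_hankel_2_1 f) = (1 - \<alpha>)\<^sup>2 * (cos \<beta>)\<^sup>2 / 12 * 3"
      using b by (simp only: norm_mult nc) (simp add: norm_power)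
    then show ?thesis by simp
  qed
  ultimately show ?thesis using bound by blast
qed

end
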